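(* Let $\mathbb{F}$ be a field and let $\alpha,\beta\in\mathbb{F}$ with $1,\alpha,\beta$ pairwise distinct. Let $A$ be a primitive $\mathcal{J}(\alpha,\beta)$-axial algebra over $\mathbb{F}$ generated by two linearly independent primitive axes $a,b$. Write $b=\delta a+b_\alpha+b_\beta$, where $\delta\in\mathbb{F}$, $b_\alpha\in A_\alpha(a)$, $b_\beta\in A_\beta(a)$. Then one of the following statements holds: (i) The projection of $a$ on $A_1(b)$ equals $\delta b$. (ii) $A$ is a $2$-dimensional algebra such that $A_\alpha(a)=A_\beta(b)=0$, $ab=\alpha a+\beta b$, and the condition $2\alpha\beta=-(\beta-1)$ holds for its fusion law eigenvalues. These options are mutually exclusive.
   Context: Algebras are commutative but not necessarily associative. For an element $a$ of an $\mathbb{F}$-algebra $A$ and $\lambda\in\mathbb{F}$, $A_\lambda(a)=\{x\in A: ax=\lambda x\}$ (possibly zero). $\langle\ldots\rangle$ denotes linear span. A $\mathcal{J}(\alpha,\beta)$-axis is a nonzero idempotent $a\in A$ such that $A=A_1(a)\oplus A_\alpha(a)\oplus A_\beta(a)$ and the fusion law holds: $A_1(a)A_\lambda(a)\subseteq A_\lambda(a)$ for $\lambda\in\{1,\alpha,\beta\}$, $A_\alpha(a)A_\alpha(a)\subseteq A_1(a)\oplus A_\alpha(a)$, $A_\alpha(a)A_\beta(a)\subseteq A_\beta(a)$, $A_\beta(a)A_\beta(a)\subseteq A_1(a)\oplus A_\alpha(a)$. "Axis" means $\mathcal{J}(\alpha,\beta)$-axis. An axis $a$ is primitive if $A_1(a)=\langle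 a\rangle$. A primitive $\mathcal{J}(\alpha,\beta)$-axial algebra is a commutative algebra generated (as an algebra) by a set of primitive $\mathcal{J}(\alpha,\beta)$-axes. The projection of $a$ on $A_1(b)$ is taken along $A_\alpha(b)\oplus A_\beta(b)$.
   Formalization: Option (ii) is taken up to exchanging a and b: it may hold for (a,b) or for (b,a). As printed, for an ordered pair, the claim fails, e.g. over Q with α=-1/4, β=2 and A=⟨a,b⟩, ab=βa+αb; mutual exclusivity is proved for this larger (ii). *)

theory Defs
  imports Complex_Main "HOL-Library.Set_Algebras"
begin

text \<open>
  The algebra is the whole type \<open>'a\<close>, the field is the type \<open>'f\<close>;
  \<open>scale\<close> is scalar multiplication and \<open>mult\<close> the (non-associative) product.
  Sums \<open>U + V\<close> of sets are the elementwise sums of \<open>Set_Algebras\<close>.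
\<close>

locale comm_nonassoc_algebra = vector_space scale
  for scale :: "'f::field \<Rightarrow> 'a::ab_group_add \<Rightarrow> 'a" +
  fixes mult :: "'a \<Rightarrow> 'a \<Rightarrow> 'a"
  assumes mult_commute: "mult x y = mult y x"
    and mult_add_left: "mult (x + y) z = mult x z + mult y z"
    and mult_scale_left: "mult (scale c x) y = scale c (mult x y)"

definition subalgebra ::
  "('f::field \<Rightarrow> 'a::ab_group_add \<Rightarrow> 'a) \<Rightarrow> ('a \<Rightarrow> 'a \<Rightarrow> 'a) \<Rightarrow> 'a set \<Rightarrow> bool" where
  "subalgebra scale mult S \<longleftrightarrow>
     module.subspace scale S \<and> (\<forall>x\<in>S. \<forall>y\<in>S. mult x y \<in> S)"

definition eigenspace ::
  "('f::field \<Rightarrow> 'a::ab_group_add \<Rightarrow> 'a) \<Rightarrow> ('a \<Rightarrow> 'a \<Rightarrow> 'a) \<Rightarrow> 'a \<Rightarrow> 'f \<Rightarrow> 'a set" where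
  "eigenspace scale mult a l = {x. mult a x = scale l x}"

definition is_direct_sum3 :: "'a::ab_group_add set \<Rightarrow> 'a set \<Rightarrow> 'a set \<Rightarrow> bool" where
  "is_direct_sum3 U V W \<longleftrightarrow>
     (\<forall>x. \<exists>!(u, v, w). u \<in> U \<and> v \<in> V \<and> w \<in> W \<and> x = u + v + w)"

definition axis ::
  "('f::field \<Rightarrow> 'a::ab_group_add \<Rightarrow> 'a) \<Rightarrow> ('a \<Rightarrow> 'a \<Rightarrow> 'a) \<Rightarrow> 'f \<Rightarrow> 'f \<Rightarrow> 'a \<Rightarrow> bool" where
  "axis scale mult \<alpha> \<beta> a \<longleftrightarrow>
     (let E = eigenspace scale mult a in
       a \<noteq> 0 \<and> mult a a = a \<and>
       is_direct_sum3 (E 1) (E \<alpha>) (E \<beta>) \<and>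
       (\<forall>l\<in>{1, \<alpha>, \<beta>}. \<forall>x\<in>E 1. \<forall>y\<in>E l. mult x y \<in> E l) \<and>
       (\<forall>x\<in>E \<alpha>. \<forall>y\<in>E \<alpha>. mult x y \<in> E 1 + E \<alpha>) \<and>
       (\<forall>x\<in>E \<alpha>. \<forall>y\<in>E \<beta>. mult x y \<in> E \<beta>) \<and>
       (\<forall>x\<in>E \<beta>. \<forall>y\<in>E \<beta>. mult x y \<in> E 1 + E \<alpha>))"

definition primitive_axis ::
  "('f::field \<Rightarrow> 'a::ab_group_add \<Rightarrow> 'a) \<Rightarrow> ('a \<Rightarrow> 'a \<Rightarrow> 'a) \<Rightarrow> 'f \<Rightarrow> 'f \<Rightarrow> 'a \<Rightarrow> bool" where
  "primitive_axis scale mult \<alpha> \<beta> a \<longleftrightarrow>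
     axis scale mult \<alpha> \<beta> a \<and> eigenspace scale mult a 1 = module.span scale {a}"

definition primitive_axial_algebra_generated_by ::
  "('f::field \<Rightarrow> 'a::ab_group_add \<Rightarrow> 'a) \<Rightarrow> ('a \<Rightarrow> 'a \<Rightarrow> 'a) \<Rightarrow> 'f \<Rightarrow> 'f \<Rightarrow> 'a set \<Rightarrow> bool" where
  "primitive_axial_algebra_generated_by scale mult \<alpha> \<beta> X \<longleftrightarrow>
     comm_nonassoc_algebra scale mult \<and>
     (\<forall>x\<in>X. primitive_axis scale mult \<alpha> \<beta> x) \<and>
     subalgebra scale mult hull X = UNIV"

text \<open>
  Projection of \<open>x\<close> on the 1-eigenspace of \<open>b\<close> along the sum of the other two;
  the description is only meaningful when \<open>b\<close> is an axis.
\<close>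

definition proj1 ::
  "('f::field \<Rightarrow> 'a::ab_group_add \<Rightarrow> 'a) \<Rightarrow> ('a \<Rightarrow> 'a \<Rightarrow> 'a) \<Rightarrow> 'f \<Rightarrow> 'f \<Rightarrow> 'a \<Rightarrow> 'a \<Rightarrow> 'a" where
  "proj1 scale mult \<alpha> \<beta> b x =
     (THE u. u \<in> eigenspace scale mult b 1 \<and>
        x - u \<in> eigenspace scale mult b \<alpha> + eigenspace scale mult b \<beta>)"

text \<open>The condition is not symmetric in the two axes.\<close>

definition exceptional_pair ::
  "('f::field \<Rightarrow> 'a::ab_group_add \<Rightarrow> 'a) \<Rightarrow> ('a \<Rightarrow> 'a \<Rightarrow> 'a) \<Rightarrow> 'f \<Rightarrow> 'f \<Rightarrow> 'a \<Rightarrow> 'a \<Rightarrow> bool" where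
  "exceptional_pair scale mult \<alpha> \<beta> a b \<longleftrightarrow>
     vector_space.dim scale (UNIV :: 'a set) = 2 \<and>
     eigenspace scale mult a \<alpha> = {0} \<and>
     eigenspace scale mult b \<beta> = {0} \<and>
     mult a b = scale \<alpha> a + scale \<beta> b \<and>
     2 * \<alpha> * \<beta> = - (\<beta> - 1)"

end

theory Submission imports Defs
begin

text \<open>
  Put \<open>p = ab\<close> and let \<open>\<epsilon>b\<close> be the projection of \<open>a\<close> on \<open>A\<^sub>1(b)\<close>. The vectors
  \<open>X = p - \<beta>b - \<delta>(1 - \<beta>)a\<close> and \<open>Y = p - \<alpha>b - \<delta>(1 - \<alpha>)a\<close> are multiples of \<open>b\<^sub>\<alpha>\<close> and \<open>b\<^sub>\<beta>\<close>,
  so \<open>ap\<close> lies in the span of \<open>a, b, p\<close>; the component of \<open>b\<^sup>2 = b\<close> in \<open>A\<^sub>\<beta>(a)\<close> determines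
  \<open>2XY\<close> and hence \<open>2p\<^sup>2\<close>.

  If \<open>a, b, p\<close> are independent, then 2 is nonzero, and comparing the \<open>p\<close>-coefficients of the
  expressions for \<open>2p\<^sup>2\<close> obtained from \<open>a\<close> and from \<open>b\<close> gives
  \<open>(\<delta> - \<epsilon>)(\<alpha> + \<beta>)(1 - \<alpha>) = 0\<close>. When \<open>\<beta> = -\<alpha>\<close>, the fusion rule for \<open>X\<^sup>2\<close> and its
  counterpart for \<open>b\<close> give \<open>\<alpha>\<delta> + (1 + \<alpha>)\<epsilon> = 0 = \<alpha>\<epsilon> + (1 + \<alpha>)\<delta>\<close>, so again \<open>\<delta> = \<epsilon>\<close>.

  If \<open>p = \<mu>a + \<nu>b\<close>, then \<open>\<mu>, \<nu> \<in> {\<alpha>, \<beta>}\<close>, with \<open>\<mu> = \<delta>(1 - \<nu>)\<close> and \<open>\<nu> = \<epsilon>(1 - \<mu>)\<close>. Equal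
  coefficients give \<open>\<delta> = \<epsilon>\<close>, different ones the exceptional algebra, where the fusion rule
  for \<open>Y\<^sup>2\<close> forces \<open>2\<alpha>\<beta> = -(\<beta> - 1)\<close>; this equation also excludes \<open>\<delta> = \<epsilon>\<close>.
\<close>

section \<open>Bilinear computation, coordinates and the even part of an axis\<close>

context comm_nonassoc_algebra
begin

abbreviation eig :: "'a \<Rightarrow> 'f \<Rightarrow> 'a set" where
  "eig \<equiv> eigenspace scale mult"

lemma mult_add_right: "mult z (x + y) = mult z x + mult z y"
  by (metis mult_commute mult_add_left)

lemma mult_scale_right: "mult y (scale c x) = scale c (mult y x)"
  by (metis mult_commute mult_scale_left)

lemma scale_double: "scale (2 * c) x = scale c x + scale c x"
  using scale_left_distrib[of c c x] by simp

lemma mult_zero_right: "mult x 0 = 0"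
  using mult_scale_right[of x 0 0] by simp

lemma subspace_eigenspace: "subspace (eig a l)"
  by (rule subspaceI)
    (auto simp: eigenspace_def mult_zero_right mult_add_right mult_scale_right
      scale_right_distrib mult.commute)

text \<open>Kept folded, so that linear identities among \<open>a\<close>, \<open>b\<close> and
  \<open>p = ab\<close> turn into identities between coefficients.\<close>

definition comb :: "'a \<Rightarrow> 'a \<Rightarrow> 'a \<Rightarrow> 'f \<Rightarrow> 'f \<Rightarrow> 'f \<Rightarrow> 'a" where
  "comb x y z u v w = scale u x + scale v y + scale w z"

lemma comb_add: "comb x y z u v w + comb x y z u' v' w' = comb x y z (u + u') (v + v') (w + w')"
  by (simp add: comb_def scale_left_distrib)

lemma comb_scale: "scale c (comb x y z u v w) = comb x y z (c * u) (c * v) (c * w)"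
  by (simp add: comb_def scale_right_distrib)

lemma comb_diff: "comb x y z u v w - comb x y z u' v' w' = comb x y z (u - u') (v - v') (w - w')"
  by (simp add: comb_def scale_left_diff_distrib)

lemma mult_comb_right: "mult t (comb x y z u v w) =
    scale u (mult t x) + scale v (mult t y) + scale w (mult t z)"
  by (simp add: comb_def mult_add_right mult_scale_right)

lemmas comb_linear = comb_add comb_scale comb_diff

lemma comb_eqD:
  assumes "independent {x, y}" "x \<noteq> y" "z \<notin> span {x, y}"
    and "comb x y z u v w = comb x y z u' v' w'"
  shows "u = u' \<and> v = v' \<and> w = w'"
proof -
  have ind: "independent {z, x, y}" and zn: "z \<notin> {x, y}"
    using assms(1,3) span_base by (auto simp: independent_insert)
  have "comb x y z (u - u') (v - v') (w - w') = 0"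
    using assms(4) by (simp flip: comb_diff)
  then have "(\<Sum>t\<in>{z, x, y}. scale (if t = x then u - u' else if t = y then v - v' else w - w') t) = 0"
    using assms(2) zn by (auto simp: comb_def algebra_simps)
  from independentD[OF ind _ _ this] show ?thesis
    using assms(2) zn by fastforce
qed

lemma pair_eqD:
  assumes "independent {x, y}" "x \<noteq> y"
    and "scale u x + scale v y = scale u' x + scale v' y"
  shows "u = u' \<and> v = v'"
proof -
  have "scale (u - u') x + scale (v - v') y = 0"
    using assms(3) by (simp add: scale_left_diff_distrib algebra_simps)
  then have "(\<Sum>t\<in>{x, y}. scale (if t = x then u - u' else v - v') t) = 0"
    using assms(2) by (auto simp: algebra_simps)
  from independentD[OF assms(1) _ _ this] show ?thesis
    using assms(2) by fastforce
qed

text \<open>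
  The even part \<open>A\<^sub>1(a) + A\<^sub>\<alpha>(a)\<close> is annihilated by \<open>(ad a - 1)(ad a - \<alpha>)\<close>; in this form
  membership can be tested on coordinates.
\<close>

definition even_part :: "'f \<Rightarrow> 'a \<Rightarrow> 'a set" where
  "even_part \<alpha> a = {z. mult a (mult a z) - scale (1 + \<alpha>) (mult a z) + scale \<alpha> z = 0}"

lemma subspace_even_part: "subspace (even_part \<alpha> a)"
proof (rule subspaceI)
  show "0 \<in> even_part \<alpha> a" by (simp add: even_part_def mult_zero_right)
next
  fix x y assume "x \<in> even_part \<alpha> a" "y \<in> even_part \<alpha> a"
  then have "(mult a (mult a x) - scale (1 + \<alpha>) (mult a x) + scale \<alpha> x)
      + (mult a (mult a y) - scale (1 + \<alpha>) (mult a y) + scale \<alpha> y) = 0"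
    by (simp add: even_part_def)
  then show "x + y \<in> even_part \<alpha> a"
    by (simp add: even_part_def mult_add_right scale_right_distrib algebra_simps)
next
  fix c x assume "x \<in> even_part \<alpha> a"
  then have "scale c (mult a (mult a x) - scale (1 + \<alpha>) (mult a x) + scale \<alpha> x) = 0"
    by (simp add: even_part_def)
  then show "scale c x \<in> even_part \<alpha> a"
    by (simp add: even_part_def mult_scale_right scale_right_distrib scale_right_diff_distrib mult.commute)
qed

lemma eigenspace_subset_even_part: "l = 1 \<or> l = \<alpha> \<Longrightarrow> eig a l \<subseteq> even_part \<alpha> a"
  by (auto simp: eigenspace_def even_part_def mult_scale_right scale_left_distrib)

lemma eigenspace_sum_subset_even_part: "eig a 1 + eig a \<alpha> \<subseteq> even_part \<alpha> a"
proof
  fix z assume "z \<in> eig a 1 + eig a \<alpha>"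
  then obtain u v where "z = u + v" "u \<in> eig a 1" "v \<in> eig a \<alpha>"
    by (auto elim: set_plus_elim)
  then show "z \<in> even_part \<alpha> a"
    using eigenspace_subset_even_part[of 1 \<alpha> a] eigenspace_subset_even_part[of \<alpha> \<alpha> a]
    by (auto intro: subspace_add[OF subspace_even_part])
qed

text \<open>On the \<beta>-eigenspace the quadratic operator that defines the even part is the
  nonzero scalar (\<beta> - 1)(\<beta> - \<alpha>).\<close>

lemma even_part_Int_odd:
  assumes "\<beta> \<noteq> 1" "\<beta> \<noteq> \<alpha>" "z \<in> even_part \<alpha> a" "z \<in> eig a \<beta>"
  shows "z = 0"
proof -
  have "scale (\<beta> * \<beta> - (1 + \<alpha>) * \<beta> + \<alpha>) z = 0"
    using assms(3,4)
    by (simp add: even_part_def eigenspace_def mult_scale_right scale_left_diff_distrib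
        scale_left_distrib distrib_right)
  moreover have "\<beta> * \<beta> - (1 + \<alpha>) * \<beta> + \<alpha> = (\<beta> - 1) * (\<beta> - \<alpha>)"
    by (simp add: algebra_simps)
  ultimately show ?thesis using assms(1,2) by simp
qed

section \<open>Decomposition and projection with respect to a primitive axis\<close>

context
  fixes \<alpha> \<beta> :: 'f
  assumes \<alpha>1: "\<alpha> \<noteq> 1" and \<beta>1: "\<beta> \<noteq> 1" and \<alpha>\<beta>: "\<alpha> \<noteq> \<beta>"
begin

lemma primitive_axis_idem: "primitive_axis scale mult \<alpha> \<beta> a \<Longrightarrow> mult a a = a"
  by (simp add: primitive_axis_def axis_def Let_def)

lemma primitive_axis_nz: "primitive_axis scale mult \<alpha> \<beta> a \<Longrightarrow> a \<noteq> 0"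
  by (simp add: primitive_axis_def axis_def Let_def)

lemma primitive_axis_direct_sum:
  "primitive_axis scale mult \<alpha> \<beta> a \<Longrightarrow> is_direct_sum3 (eig a 1) (eig a \<alpha>) (eig a \<beta>)"
  unfolding primitive_axis_def axis_def Let_def by blast

lemma primitive_axis_eigenspace_1:
  "primitive_axis scale mult \<alpha> \<beta> a \<Longrightarrow> eig a 1 = span {a}"
  unfolding primitive_axis_def by blast

lemma primitive_axis_decomp:
  assumes "primitive_axis scale mult \<alpha> \<beta> a"
  obtains c x y where "z = scale c a + x + y" "x \<in> eig a \<alpha>" "y \<in> eig a \<beta>"
proof -
  have "is_direct_sum3 (eig a 1) (eig a \<alpha>) (eig a \<beta>)" and 1: "eig a 1 = span {a}"
    using assms primitive_axis_direct_sum primitive_axis_eigenspace_1 by blast+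
  then obtain u x y where "u \<in> eig a 1" "x \<in> eig a \<alpha>" "y \<in> eig a \<beta>" "z = u + x + y"
    unfolding is_direct_sum3_def by blast
  with 1 that show ?thesis by (auto simp: span_singleton)
qed

text \<open>Any other candidate for the projection yields a second decomposition of
  \<open>z\<close>, which the direct sum excludes.\<close>

lemma proj1_eq:
  assumes "primitive_axis scale mult \<alpha> \<beta> b"
    and "z = scale c b + x + y" "x \<in> eig b \<alpha>" "y \<in> eig b \<beta>"
  shows "proj1 scale mult \<alpha> \<beta> b z = scale c b"
  unfolding proj1_def
proof (rule the_equality)
  have ds: "is_direct_sum3 (eig b 1) (eig b \<alpha>) (eig b \<beta>)" and 1: "eig b 1 = span {b}"
    using assms(1) primitive_axis_direct_sum primitive_axis_eigenspace_1 by blast+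
  have cb: "scale c b \<in> eig b 1" using 1 by (simp add: span_base span_scale)
  show "scale c b \<in> eig b 1 \<and> z - scale c b \<in> eig b \<alpha> + eig b \<beta>"
    using cb assms(2-4) by (auto simp: algebra_simps)
  fix u assume u: "u \<in> eig b 1 \<and> z - u \<in> eig b \<alpha> + eig b \<beta>"
  then obtain x' y' where xy: "x' \<in> eig b \<alpha>" "y' \<in> eig b \<beta>" "z - u = x' + y'"
    by (auto elim: set_plus_elim)
  then have "z = u + x' + y'" by (simp add: algebra_simps)
  with ds u xy cb assms(2-4) show "u = scale c b"
    unfolding is_direct_sum3_def by blast
qed

section \<open>Relations forced by the eigenvector decomposition of an idempotent\<close>

text \<open>Since \<open>X\<close> and \<open>Y\<close> are nonzero multiples of \<open>x\<close>
  and \<open>y\<close>, the fusion rules of \<open>a\<close> pass to them, now in coordinates over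
  \<open>a\<close>, \<open>b\<close>, \<open>p\<close> that can be shared with the other axis. The
  last relation keeps its factor 2 because the characteristic may be 2.\<close>

lemma pair_relations:
  assumes a: "primitive_axis scale mult \<alpha> \<beta> a" and bb: "mult b b = b"
    and b: "b = scale \<delta> a + x + y" and x: "x \<in> eig a \<alpha>" and y: "y \<in> eig a \<beta>"
  defines "p \<equiv> mult a b"
  defines "X \<equiv> comb a b p (- \<delta> * (1 - \<beta>)) (- \<beta>) 1"
    and "Y \<equiv> comb a b p (- \<delta> * (1 - \<alpha>)) (- \<alpha>) 1"
  shows "mult a p = comb a b p (\<delta> * (1 - \<alpha>) * (1 - \<beta>)) (- \<alpha> * \<beta>) (\<alpha> + \<beta>)"
    and "mult X X \<in> even_part \<alpha> a"
    and "mult Y Y \<in> even_part \<alpha> a"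
    and "scale 2 (mult X Y) = scale ((\<alpha> - \<beta>) * (1 - 2 * \<delta> * \<beta>)) Y"
proof -
  have aa: "mult a a = a" using a by (rule primitive_axis_idem)
  have ax: "mult a x = scale \<alpha> x" and ay: "mult a y = scale \<beta> y"
    using x y by (auto simp: eigenspace_def)
  have b': "b = comb a x y \<delta> 1 1" using b by (simp add: comb_def)
  have mc: "mult a (comb a x y u v w) = comb a x y u (\<alpha> * v) (\<beta> * w)" for u v w
    by (simp add: comb_def mult_add_right mult_scale_right aa ax ay mult.commute)
  have p': "p = comb a x y \<delta> \<alpha> \<beta>"
    unfolding p_def by (subst b', subst mc) simp
  \<comment> \<open>Change to coordinates over \<open>a\<close>, \<open>x\<close>, \<open>y\<close>,
    where multiplication by \<open>a\<close> is diagonal.\<close>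
  have expand: "comb a b p u v w = comb a x y (u + v * \<delta> + w * \<delta>) (v + w * \<alpha>) (v + w * \<beta>)" for u v w
    by (simp add: comb_def b p' scale_left_distrib scale_right_distrib algebra_simps)
  show "mult a p = comb a b p (\<delta> * (1 - \<alpha>) * (1 - \<beta>)) (- \<alpha> * \<beta>) (\<alpha> + \<beta>)"
    unfolding expand unfolding p' mc by (simp add: algebra_simps)
  have X: "X = scale (\<alpha> - \<beta>) x" and Y: "Y = scale (\<beta> - \<alpha>) y"
    unfolding X_def Y_def expand by (simp_all add: comb_def algebra_simps)
  have fus: "mult x x \<in> even_part \<alpha> a" "mult y y \<in> even_part \<alpha> a" "mult x y \<in> eig a \<beta>"
    using a x y eigenspace_sum_subset_even_part[of a \<alpha>]
    by (auto simp: primitive_axis_def axis_def Let_def)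
  show "mult X X \<in> even_part \<alpha> a" "mult Y Y \<in> even_part \<alpha> a"
    unfolding X Y using fus
    by (auto simp: mult_scale_left mult_scale_right simp del: scale_scale
        intro!: subspace_scale[OF subspace_even_part])
  \<comment> \<open>\<open>od\<close> and \<open>ev\<close> are the odd and even components of
    \<open>mult b b - b\<close>; their sum vanishes, hence so does \<open>od\<close>.\<close>
  define od where "od = scale (2 * \<delta> * \<beta> - 1) y + scale 2 (mult x y)"
  define ev where "ev = scale (\<delta> * \<delta> - \<delta>) a + mult x x + mult y y + scale (2 * \<delta> * \<alpha> - 1) x"
  have xa: "mult x a = scale \<alpha> x" and ya: "mult y a = scale \<beta> y" and yx: "mult y x = mult x y"
    using ax ay mult_commute by metis+
  have "mult b b = scale (\<delta> * \<delta>) a + (scale (\<delta> * \<alpha>) x + scale (\<delta> * \<alpha>) x)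
      + (scale (\<delta> * \<beta>) y + scale (\<delta> * \<beta>) y) + mult x x + mult y y + (mult x y + mult x y)"
    unfolding b
    by (simp add: mult_add_left mult_add_right mult_scale_left mult_scale_right
        aa ax ay xa ya yx scale_right_distrib ac_simps)
  also have "\<dots> = comb a x y (\<delta> * \<delta>) (2 * \<delta> * \<alpha>) (2 * \<delta> * \<beta>)
      + mult x x + mult y y + scale 2 (mult x y)"
    by (simp add: comb_def mult.assoc scale_double scale_double[of 1, simplified])
  finally have "comb a x y \<delta> 1 1 = comb a x y (\<delta> * \<delta>) (2 * \<delta> * \<alpha>) (2 * \<delta> * \<beta>)
      + mult x x + mult y y + scale 2 (mult x y)"
    unfolding bb b'[symmetric] .
  then have "ev + od = 0"
    unfolding ev_def od_def
    by (simp add: comb_def scale_left_diff_distrib algebra_simps)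
  then have "od = - ev" by (simp add: eq_neg_iff_add_eq_0 add.commute)
  moreover have "ev \<in> even_part \<alpha> a"
    unfolding ev_def using fus aa x eigenspace_subset_even_part[of 1 \<alpha> a] eigenspace_subset_even_part[of \<alpha> \<alpha> a]
    by (intro subspace_add[OF subspace_even_part] subspace_scale[OF subspace_even_part])
      (auto simp: eigenspace_def)
  moreover have "od \<in> eig a \<beta>"
    unfolding od_def using fus y
    by (intro subspace_add[OF subspace_eigenspace] subspace_scale[OF subspace_eigenspace])
  ultimately have "od = 0"
    using even_part_Int_odd \<beta>1 \<alpha>\<beta> subspace_neg[OF subspace_even_part] by metis
  then have xy: "scale 2 (mult x y) = scale (1 - 2 * \<delta> * \<beta>) y"
    unfolding od_def by (simp add: scale_left_diff_distrib algebra_simps)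
  have "scale 2 (mult X Y) = scale ((\<alpha> - \<beta>) * (\<beta> - \<alpha>)) (scale 2 (mult x y))"
    unfolding X Y by (simp add: mult_scale_left mult_scale_right mult.commute mult.left_commute)
  also have "\<dots> = scale ((\<alpha> - \<beta>) * (1 - 2 * \<delta> * \<beta>)) Y"
    unfolding xy Y by (simp add: mult.commute mult.left_commute)
  finally show "scale 2 (mult X Y) = scale ((\<alpha> - \<beta>) * (1 - 2 * \<delta> * \<beta>)) Y" .
qed

text \<open>The formula for \<open>mult a p\<close> makes \<nu> a root of (\<nu> - \<alpha>)(\<nu> -
  \<beta>) and then determines \<mu>. The last condition for \<nu> = \<beta> comes from the fusion
  rule for \<open>Y\<close>; it becomes the exceptional equation when \<mu> = \<alpha>.\<close>

lemma decomp_2dim: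
  assumes a: "primitive_axis scale mult \<alpha> \<beta> a" and bb: "mult b b = b"
    and b: "b = scale \<delta> a + x + y" and x: "x \<in> eig a \<alpha>" and y: "y \<in> eig a \<beta>"
    and ind: "independent {a, b}" "a \<noteq> b"
    and p: "mult a b = scale \<mu> a + scale \<nu> b"
  shows "(\<nu> = \<alpha> \<and> \<mu> = \<delta> * (1 - \<alpha>)) \<or> (\<nu> = \<beta> \<and> \<mu> = \<delta> * (1 - \<beta>) \<and> 2 * \<mu> * \<beta> = - (\<beta> - 1))"
proof -
  note rel = pair_relations[OF a bb b x y]
  have aa: "mult a a = a" using a by (rule primitive_axis_idem)
  have ba: "mult b a = scale \<mu> a + scale \<nu> b" using p mult_commute by metis
  have ma: "mult a (scale u a + scale v b) = scale (u + v * \<mu>) a + scale (v * \<nu>) b" for u v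
    by (simp add: mult_add_right mult_scale_right aa p scale_left_distrib scale_right_distrib)
  have c: "comb a b (mult a b) u v w = scale (u + w * \<mu>) a + scale (v + w * \<nu>) b" for u v w
    by (simp add: comb_def p scale_left_distrib scale_right_distrib algebra_simps)
  have "mult a (mult a b) = scale (\<mu> + \<nu> * \<mu>) a + scale (\<nu> * \<nu>) b"
    by (subst p) (rule ma)
  with rel(1) have eqs: "\<mu> + \<nu> * \<mu> = \<delta> * (1 - \<alpha>) * (1 - \<beta>) + (\<alpha> + \<beta>) * \<mu>"
    "\<nu> * \<nu> = - \<alpha> * \<beta> + (\<alpha> + \<beta>) * \<nu>"
    unfolding c using pair_eqD[OF ind] by metis+
  have "(\<nu> - \<alpha>) * (\<nu> - \<beta>) = 0" using eqs(2) by (simp add: algebra_simps)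
  then consider "\<nu> = \<alpha>" | "\<nu> = \<beta>" by auto
  then show ?thesis
  proof cases
    case 1
    have "(1 - \<beta>) * (\<mu> - \<delta> * (1 - \<alpha>)) = 0" using eqs(1) unfolding 1 by algebra
    with 1 \<beta>1 show ?thesis by simp
  next
    case 2
    have "(1 - \<alpha>) * (\<mu> - \<delta> * (1 - \<beta>)) = 0" using eqs(1) unfolding 2 by algebra
    with \<alpha>1 have \<mu>: "\<mu> = \<delta> * (1 - \<beta>)" by simp
    define u where "u = \<mu> - \<delta> * (1 - \<alpha>)"
    define v where "v = \<beta> - \<alpha>"
    \<comment> \<open>Here \<open>X\<close> vanishes, so only the square of \<open>Y\<close> carries
      information.\<close>
    have Y: "comb a b (mult a b) (- \<delta> * (1 - \<alpha>)) (- \<alpha>) 1 = scale u a + scale v b"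
      unfolding c u_def v_def 2 by (simp add: algebra_simps)
    have "mult (scale u a + scale v b) (scale u a + scale v b)
        = scale (u * u + 2 * (u * v * \<mu>)) a + scale (v * v + 2 * (u * v * \<beta>)) b"
      unfolding scale_left_distrib scale_double
      by (simp add: mult_add_right mult_add_left mult_scale_right mult_scale_left aa bb p ba 2
          scale_left_distrib scale_right_distrib ac_simps)
    with rel(3) obtain k where ev: "scale k a + scale (v * v + 2 * (u * v * \<beta>)) b \<in> even_part \<alpha> a"
      unfolding Y by metis
    define l where "l = v * v + 2 * (u * v * \<beta>)"
    \<comment> \<open>Modulo \<open>a\<close>, multiplication by \<open>a\<close> sends
      \<open>b\<close> to \<beta>\<open>b\<close>; evenness therefore forces (\<beta> - 1)(\<beta> -
      \<alpha>)\<open>l\<close> = 0 for the \<open>b\<close>-coefficient \<open>l\<close>.\<close>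
    have "scale (k + l * \<mu> + l * \<beta> * \<mu> - (1 + \<alpha>) * (k + l * \<mu>) + \<alpha> * k) a
      + scale (l * \<beta> * \<beta> - (1 + \<alpha>) * (l * \<beta>) + \<alpha> * l) b = scale 0 a + scale 0 b"
      using ev unfolding l_def[symmetric] even_part_def mem_Collect_eq ma 2
      by (simp add: scale_left_distrib scale_right_distrib scale_left_diff_distrib algebra_simps)
    then have "l * \<beta> * \<beta> - (1 + \<alpha>) * (l * \<beta>) + \<alpha> * l = 0"
      using pair_eqD[OF ind] by metis
    then have "(\<beta> - 1) * (\<beta> - \<alpha>) * l = 0" by algebra
    then have "l = 0" using \<beta>1 \<alpha>\<beta> by simp
    then have "(\<beta> - \<alpha>) * (\<beta> - \<alpha>) * (1 - 2 * \<delta> * \<beta>) = 0"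
      unfolding l_def u_def v_def \<mu> by algebra
    then have "2 * \<delta> * \<beta> = 1" using \<alpha>\<beta> by simp
    then have "2 * \<mu> * \<beta> = - (\<beta> - 1)" unfolding \<mu> by algebra
    with 2 \<mu> show ?thesis by simp
  qed
qed

text \<open>In the basis \<open>a\<close>, \<open>b\<close>, multiplication by \<open>a\<close> is
  triangular with eigenvalues 1 and \<beta>, both different from \<alpha>. Exchanging \<alpha> with
  \<beta> and \<open>a\<close> with \<open>b\<close> gives the statement for the other axis.\<close>

lemma eigenspace_trivial_2dim:
  assumes "UNIV = span {a, b}" "independent {a, b}" "a \<noteq> b" "mult a a = a"
    and "mult a b = scale \<alpha> a + scale \<beta> b"
  shows "eig a \<alpha> = {0}"
proof -
  have "z = 0" if z: "mult a z = scale \<alpha> z" for z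
  proof -
    have "z \<in> span {a, b}" using assms(1) by auto
    then obtain u v where uv: "z = scale u a + scale v b"
      by (auto simp: span_insert span_singleton algebra_simps)
    have "scale (u + v * \<alpha>) a + scale (v * \<beta>) b = scale (\<alpha> * u) a + scale (\<alpha> * v) b"
      using z unfolding uv
      by (simp add: mult_add_right mult_scale_right assms scale_left_distrib scale_right_distrib
          algebra_simps)
    then have "u + v * \<alpha> = \<alpha> * u" "v * \<beta> = \<alpha> * v"
      using pair_eqD[OF assms(2,3)] by metis+
    then have "v = 0" "u = 0" using \<alpha>1 \<alpha>\<beta> by (auto simp: mult.commute)
    then show ?thesis by (simp add: uv)
  qed
  then show ?thesis by (auto simp: eigenspace_def mult_zero_right)
qed

section \<open>The case of independent \<open>a\<close>, \<open>b\<close> and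
  \<open>ab\<close>\<close>

text \<open>The \<open>p\<close>-coordinate of the quadratic operator at this vector is (\<beta> -
  1)(\<open>v\<close> + \<beta>\<open>w\<close>), so evenness becomes a linear condition on
  coordinates.\<close>

lemma even_part_coord:
  assumes ind: "independent {a, b}" "a \<noteq> b" "p \<notin> span {a, b}"
    and aa: "mult a a = a" and ab: "mult a b = p"
    and ap: "mult a p = comb a b p k (- \<alpha> * \<beta>) (\<alpha> + \<beta>)"
    and ev: "comb a b p u v w \<in> even_part \<alpha> a"
  shows "v + \<beta> * w = 0"
proof -
  have ma: "mult a (comb a b p u v w) = comb a b p (u + k * w) (- \<alpha> * \<beta> * w) (v + (\<alpha> + \<beta>) * w)"
    for u v w
    by (simp add: mult_comb_right aa ab ap)
      (simp add: comb_def scale_left_distrib scale_right_distrib scale_right_diff_distrib algebra_simps)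
  obtain l m where "comb a b p l m
      (- \<alpha> * \<beta> * w + (\<alpha> + \<beta>) * (v + (\<alpha> + \<beta>) * w) - (1 + \<alpha>) * (v + (\<alpha> + \<beta>) * w) + \<alpha> * w) = 0"
    using ev unfolding even_part_def mem_Collect_eq ma comb_linear by blast
  then have "comb a b p l m
      (- \<alpha> * \<beta> * w + (\<alpha> + \<beta>) * (v + (\<alpha> + \<beta>) * w) - (1 + \<alpha>) * (v + (\<alpha> + \<beta>) * w) + \<alpha> * w)
      = comb a b p 0 0 0"
    by (simp add: comb_def)
  from conjunct2[OF conjunct2[OF comb_eqD[OF ind this]]] have "(\<beta> - 1) * (v + \<beta> * w) = 0"
    by algebra
  then show ?thesis using \<beta>1 by simp
qed

lemma decomp_symmetric_3dim:
  assumes a: "primitive_axis scale mult \<alpha> \<beta> a"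
    and b: "primitive_axis scale mult \<alpha> \<beta> b"
    and bd: "b = scale \<delta> a + x + y" "x \<in> eig a \<alpha>" "y \<in> eig a \<beta>"
    and ad: "a = scale \<epsilon> b + x' + y'" "x' \<in> eig b \<alpha>" "y' \<in> eig b \<beta>"
    and ind: "independent {a, b}" "a \<noteq> b" and nsp: "mult a b \<notin> span {a, b}"
  shows "\<delta> = \<epsilon>"
proof -
  define p where "p = mult a b"
  have aa: "mult a a = a" and bb: "mult b b = b"
    using a b primitive_axis_idem by auto
  have ab: "mult a b = p" "mult b a = p" using mult_commute by (auto simp: p_def)
  \<comment> \<open>Writes the relations for the pair \<open>b\<close>, \<open>a\<close> in the
    coordinates used for \<open>a\<close>, \<open>b\<close>.\<close>
  have swap: "comb b a p u v w = comb a b p v u w" for u v w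
    by (simp add: comb_def algebra_simps)
  have ind': "independent {b, a}" "b \<noteq> a" and nsp': "p \<notin> span {b, a}"
    using ind nsp by (auto simp: ab insert_commute)
  note eqD = comb_eqD[OF ind nsp[unfolded ab]]
  note rel = pair_relations[OF a bb bd, unfolded ab]
  note rel' = pair_relations[OF b aa ad, unfolded ab swap]
  have pa: "mult p a = mult a p" and pb: "mult p b = mult b p" using mult_commute by auto
  define P where "P = mult p p"
  \<comment> \<open>With \<open>mult a p\<close> and \<open>mult b p\<close> known, the square
    \<open>P\<close> of \<open>p\<close> is the only unknown product.\<close>
  have prod: "mult (comb a b p u v w) (comb a b p u' v' w') = scale (w * w') P + comb a b p
      (u * u' + \<delta> * (1 - \<alpha>) * (1 - \<beta>) * (u * w' + w * u') - \<alpha> * \<beta> * (v * w' + w * v'))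
      (v * v' + \<epsilon> * (1 - \<alpha>) * (1 - \<beta>) * (v * w' + w * v') - \<alpha> * \<beta> * (u * w' + w * u'))
      (u * v' + v * u' + (\<alpha> + \<beta>) * (u * w' + w * u' + v * w' + w * v'))" for u v w u' v' w'
  proof -
    have "mult (comb a b p u v w) (comb a b p u' v' w') = scale (u * u') a + scale (v * v') b
      + scale (u * v' + v * u') p + scale (u * w' + w * u') (mult a p)
      + scale (v * w' + w * v') (mult b p) + scale (w * w') P"
      unfolding comb_def mult_add_left mult_add_right mult_scale_left mult_scale_right
        aa bb ab pa pb P_def
      by (simp add: scale_left_distrib scale_right_distrib algebra_simps)
    also have "\<dots> = scale (w * w') P + (comb a b p (u * u') (v * v') (u * v' + v * u')
       + scale (u * w' + w * u') (mult a p) + scale (v * w' + w * v') (mult b p))"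
      by (simp add: comb_def algebra_simps)
    also have "comb a b p (u * u') (v * v') (u * v' + v * u')
       + scale (u * w' + w * u') (mult a p) + scale (v * w' + w * v') (mult b p) = comb a b p
      (u * u' + \<delta> * (1 - \<alpha>) * (1 - \<beta>) * (u * w' + w * u') - \<alpha> * \<beta> * (v * w' + w * v'))
      (v * v' + \<epsilon> * (1 - \<alpha>) * (1 - \<beta>) * (v * w' + w * v') - \<alpha> * \<beta> * (u * w' + w * u'))
      (u * v' + v * u' + (\<alpha> + \<beta>) * (u * w' + w * u' + v * w' + w * v'))"
      unfolding rel(1) rel'(1) comb_linear by (rule arg_cong3[where f = "comb a b p"]; algebra)
    finally show ?thesis .
  qed
  note P1 = rel(4)[unfolded prod scale_right_distrib comb_linear]
  note P2 = rel'(4)[unfolded prod scale_right_distrib comb_linear]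
  \<comment> \<open>If 2 = 0, the relation for 2\<open>XY\<close> reads 0 = (\<alpha> -
    \<beta>)\<open>Y\<close>, although \<open>Y\<close> has \<open>p\<close>-coordinate 1.\<close>
  have two: "(2::'f) \<noteq> 0"
  proof
    assume 0: "(2::'f) = 0"
    have "comb a b p ((\<alpha> - \<beta>) * (1 - 2 * \<delta> * \<beta>) * (- \<delta> * (1 - \<alpha>)))
      ((\<alpha> - \<beta>) * (1 - 2 * \<delta> * \<beta>) * - \<alpha>) ((\<alpha> - \<beta>) * (1 - 2 * \<delta> * \<beta>) * 1) = comb a b p 0 0 0"
      using rel(4) unfolding comb_linear 0 by (simp add: comb_def)
    from eqD[OF this] 0 \<alpha>\<beta> show False by simp
  qed
  have move: "scale 2 P = comb a b p (u' - u) (v' - v) (w' - w)"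
    if "scale (2 * (1 * 1)) P + comb a b p u v w = comb a b p u' v' w'" for u v w u' v' w'
    using that by (simp flip: comb_diff add: algebra_simps)
  note Q1 = move[OF P1[unfolded scale_scale]]
  note Q2 = move[OF P2[unfolded scale_scale]]
  note E = eqD[OF trans[OF Q1[symmetric] Q2]]
  \<comment> \<open>In the \<open>p\<close>-coordinate of 2\<open>P\<close> the only term with
    \<delta> is 2\<delta>(\<alpha> + \<beta>)(1 - \<alpha>); the other expression has \<epsilon> in
    its place.\<close>
  have "2 * (1 - \<alpha>) * ((\<alpha> + \<beta>) * (\<delta> - \<epsilon>)) = 0"
    using conjunct2[OF conjunct2[OF E]] by algebra
  then consider "\<delta> = \<epsilon>" | "\<beta> = - \<alpha>"
    using two \<alpha>1 by (auto simp: eq_neg_iff_add_eq_0 add.commute)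
  then show ?thesis
  proof cases
    case 2
    \<comment> \<open>For \<beta> = -\<alpha> the comparison is void, so the square of
      \<open>X\<close> is used. Doubling it lets \<open>Q1\<close> eliminate
      \<open>P\<close>.\<close>
    have "scale 2 (mult (comb a b p (- \<delta> * (1 - \<beta>)) (- \<beta>) 1)
        (comb a b p (- \<delta> * (1 - \<beta>)) (- \<beta>) 1)) \<in> even_part \<alpha> a"
      using rel(2) by (rule subspace_scale[OF subspace_even_part])
    note even_part_coord[OF ind nsp[unfolded ab] aa ab(1) rel(1)
        this[unfolded prod scale_right_distrib scale_scale mult_1_right Q1 comb_linear]]
    then have "2 * (2 * \<alpha> * (1 - \<alpha>) * (\<alpha> * \<delta> + (1 + \<alpha>) * \<epsilon>)) = 0"
      unfolding 2 by algebra
    moreover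
    have "scale 2 (mult (comb a b p (- \<beta>) (- \<epsilon> * (1 - \<beta>)) 1)
        (comb a b p (- \<beta>) (- \<epsilon> * (1 - \<beta>)) 1)) \<in> even_part \<alpha> b"
      using rel'(2) by (rule subspace_scale[OF subspace_even_part])
    note even_part_coord[OF ind' nsp' bb ab(2) rel'(1)[folded swap]
        this[unfolded prod scale_right_distrib scale_scale mult_1_right Q2 comb_linear, folded swap]]
    then have "2 * (2 * \<alpha> * (1 - \<alpha>) * (\<alpha> * \<epsilon> + (1 + \<alpha>) * \<delta>)) = 0"
      unfolding 2 by algebra
    moreover have "\<alpha> \<noteq> 0" using 2 \<alpha>\<beta> by auto
    ultimately have "\<alpha> * \<delta> + (1 + \<alpha>) * \<epsilon> = 0" "\<alpha> * \<epsilon> + (1 + \<alpha>) * \<delta> = 0"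
      using two \<alpha>1 by (simp_all only: mult_eq_0_iff right_minus_eq) auto
    \<comment> \<open>Subtracting the two equations leaves \<epsilon> - \<delta> = 0.\<close>
    then show ?thesis by algebra
  qed simp
qed

text \<open>Equality would give \<alpha>(1 - \<alpha>) = \<beta>(1 - \<beta>), hence \<alpha> +
  \<beta> = 1; the third equation then reads 2\<alpha>\<beta> = \<alpha>, which leaves only \<alpha>
  = 0, \<beta> = 1 or \<alpha> = \<beta>.\<close>

lemma exceptional_coeffs_distinct:
  assumes "\<alpha> = \<delta> * (1 - \<beta>)" "\<beta> = \<epsilon> * (1 - \<alpha>)" "2 * \<alpha> * \<beta> = - (\<beta> - 1)"
  shows "\<delta> \<noteq> \<epsilon>"
proof
  assume "\<delta> = \<epsilon>"
  then have "\<alpha> * (1 - \<alpha>) = \<beta> * (1 - \<beta>)"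
    using assms(1,2) by (metis mult.assoc mult.commute)
  then have "(\<alpha> - \<beta>) * (\<alpha> + \<beta> - 1) = 0" by (simp add: algebra_simps)
  then have sum: "\<alpha> = 1 - \<beta>" using \<alpha>\<beta> by (simp add: eq_diff_eq)
  then have "\<alpha> * (\<beta> - \<alpha>) = 0" using assms(3) by algebra
  then show False using sum \<alpha>\<beta> \<beta>1 by auto
qed

end

section \<open>Dimension two and the final dichotomy\<close>

lemma exceptional_pairI:
  assumes "\<alpha> \<noteq> 1" "\<beta> \<noteq> 1" "\<alpha> \<noteq> \<beta>"
    and "UNIV = span {a, b}" "independent {a, b}" "a \<noteq> b" "mult a a = a" "mult b b = b"
    and "mult a b = scale \<alpha> a + scale \<beta> b" "2 * \<alpha> * \<beta> = - (\<beta> - 1)"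
  shows "exceptional_pair scale mult \<alpha> \<beta> a b"
proof -
  have "dim UNIV = 2"
    using dim_eq_card[of "{a, b}" UNIV] assms(4-6) by simp
  moreover have "eig a \<alpha> = {0}"
    using assms by (intro eigenspace_trivial_2dim[of \<alpha> \<beta> a b])
  moreover have "eig b \<beta> = {0}"
  proof (rule eigenspace_trivial_2dim[of \<beta> \<alpha> b a])
    show "mult b a = scale \<beta> b + scale \<alpha> a"
      using assms(9) mult_commute[of a b] by (simp add: add.commute)
  qed (use assms in \<open>auto simp: insert_commute\<close>)
  ultimately show ?thesis using assms(9,10) by (simp add: exceptional_pair_def)
qed

text \<open>Once \<open>ab\<close> lies in the span of the two idempotents, that span is closed
  under products and so is a subalgebra containing the generators.\<close>

lemma span_UNIV_if_generated:
  assumes "subalgebra scale mult hull {a, b} = UNIV"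
    and "mult a a = a" "mult b b = b" "mult a b \<in> span {a, b}"
  shows "UNIV = span {a, b}"
proof -
  have "mult x y \<in> span {a, b}" if "x \<in> span {a, b}" "y \<in> span {a, b}" for x y
  proof -
    obtain u v u' v' where "x = scale u a + scale v b" "y = scale u' a + scale v' b"
      using \<open>x \<in> _\<close> \<open>y \<in> _\<close> by (auto simp: span_insert span_singleton algebra_simps)
    moreover have "mult b a \<in> span {a, b}" using assms(4) mult_commute by metis
    moreover have "a \<in> span {a, b}" "b \<in> span {a, b}" by (auto intro: span_base)
    ultimately show ?thesis
      using assms(2-4)
      by (auto simp: mult_add_left mult_add_right mult_scale_left mult_scale_right
          simp del: scale_scale intro!: span_add span_scale)
  qed
  then have "subalgebra scale mult (span {a, b})"
    by (simp add: subalgebra_def)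
  then have "subalgebra scale mult hull {a, b} \<subseteq> span {a, b}"
    by (intro hull_minimal) (auto intro: span_base)
  with assms(1) show ?thesis by auto
qed

end

text \<open>Alternative (ii) is read up to exchanging the axes: \<open>ab\<close> =
  \<beta>\<open>a\<close> + \<alpha>\<open>b\<close> describes the same algebra with
  \<open>a\<close> and \<open>b\<close> interchanged.\<close>

theorem proposition2:
  fixes scale :: "'f::field \<Rightarrow> 'a::ab_group_add \<Rightarrow> 'a"
    and mult :: "'a \<Rightarrow> 'a \<Rightarrow> 'a"
    and \<alpha> \<beta> \<delta> :: 'f
    and a b b\<^sub>\<alpha> b\<^sub>\<beta> :: 'a
  assumes "\<alpha> \<noteq> 1" and "\<beta> \<noteq> 1" and "\<alpha> \<noteq> \<beta>"
    and "primitive_axial_algebra_generated_by scale mult \<alpha> \<beta> {a, b}"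
    and "a \<noteq> b" and "\<not> module.dependent scale {a, b}"
    and "b = scale \<delta> a + b\<^sub>\<alpha> + b\<^sub>\<beta>"
    and "b\<^sub>\<alpha> \<in> eigenspace scale mult a \<alpha>"
    and "b\<^sub>\<beta> \<in> eigenspace scale mult a \<beta>"
  shows "(proj1 scale mult \<alpha> \<beta> b a = scale \<delta> b \<or>
          (exceptional_pair scale mult \<alpha> \<beta> a b \<or> exceptional_pair scale mult \<alpha> \<beta> b a)) \<and>
         \<not> (proj1 scale mult \<alpha> \<beta> b a = scale \<delta> b \<and>
            (exceptional_pair scale mult \<alpha> \<beta> a b \<or> exceptional_pair scale mult \<alpha> \<beta> b a))"
proof -
  interpret comm_nonassoc_algebra scale mult
    using assms(4) by (simp add: primitive_axial_algebra_generated_by_def)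
  note ev = assms(1-3)
  have a: "primitive_axis scale mult \<alpha> \<beta> a" and b: "primitive_axis scale mult \<alpha> \<beta> b"
    and gen: "subalgebra scale mult hull {a, b} = UNIV"
    using assms(4) by (auto simp: primitive_axial_algebra_generated_by_def)
  have aa: "mult a a = a" and bb: "mult b b = b"
    using a b primitive_axis_idem[OF ev] by auto
  have ind: "independent {a, b}" "a \<noteq> b" using assms by auto
  then have ind': "independent {b, a}" "b \<noteq> a" by (auto simp: insert_commute)
  obtain \<epsilon> x y where ad: "a = scale \<epsilon> b + x + y" "x \<in> eig b \<alpha>" "y \<in> eig b \<beta>"
    using primitive_axis_decomp[OF ev b] .
  have "proj1 scale mult \<alpha> \<beta> b a = scale \<epsilon> b"
    using proj1_eq[OF ev b ad] .
  \<comment> \<open>Alternative (i) thus compares the two projection coefficients.\<close>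
  then have proj: "proj1 scale mult \<alpha> \<beta> b a = scale \<delta> b \<longleftrightarrow> \<delta> = \<epsilon>"
    using primitive_axis_nz[OF ev b] by auto
  note D = decomp_2dim[OF ev a bb assms(7-9) ind]
  note D' = decomp_2dim[OF ev b aa ad ind']
  have comm: "mult b a = scale \<nu> b + scale \<mu> a" if "mult a b = scale \<mu> a + scale \<nu> b" for \<mu> \<nu>
    using that mult_commute[of a b] by (simp add: add.commute)
  have excl: "\<delta> \<noteq> \<epsilon>"
    if "exceptional_pair scale mult \<alpha> \<beta> a b \<or> exceptional_pair scale mult \<alpha> \<beta> b a"
    using that
  proof
    assume "exceptional_pair scale mult \<alpha> \<beta> a b"
    then have p: "mult a b = scale \<alpha> a + scale \<beta> b" and c: "2 * \<alpha> * \<beta> = - (\<beta> - 1)"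
      by (auto simp: exceptional_pair_def)
    have "\<alpha> = \<delta> * (1 - \<beta>)" "\<beta> = \<epsilon> * (1 - \<alpha>)"
      using D[OF p] D'[OF comm[OF p]] ev(3) by blast+
    then show ?thesis by (rule exceptional_coeffs_distinct[OF ev _ _ c])
  next
    assume "exceptional_pair scale mult \<alpha> \<beta> b a"
    then have p: "mult b a = scale \<alpha> b + scale \<beta> a" and c: "2 * \<alpha> * \<beta> = - (\<beta> - 1)"
      by (auto simp: exceptional_pair_def)
    have "mult a b = scale \<beta> a + scale \<alpha> b"
      using p mult_commute[of a b] by (simp add: add.commute)
    then have "\<alpha> = \<epsilon> * (1 - \<beta>)" "\<beta> = \<delta> * (1 - \<alpha>)"
      using D D'[OF p] ev(3) by blast+
    then show ?thesis using exceptional_coeffs_distinct[OF ev _ _ c] by blast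
  qed
  have "\<delta> = \<epsilon> \<or> exceptional_pair scale mult \<alpha> \<beta> a b \<or> exceptional_pair scale mult \<alpha> \<beta> b a"
  proof (cases "mult a b \<in> span {a, b}")
    case False
    then show ?thesis
      using decomp_symmetric_3dim[OF ev a b assms(7-9) ad ind] by simp
  next
    case True
    then obtain \<mu> \<nu> where p: "mult a b = scale \<mu> a + scale \<nu> b"
      by (auto simp: span_insert span_singleton algebra_simps)
    note p' = comm[OF p]
    have U: "UNIV = span {a, b}" using span_UNIV_if_generated[OF gen aa bb True] .
    then have U': "UNIV = span {b, a}" by (simp add: insert_commute)
    \<comment> \<open>The axis \<open>a\<close> restricts \<nu> to {\<alpha>, \<beta>}, and the axis
      \<open>b\<close> restricts \<mu>.\<close>
    consider "\<nu> = \<alpha>" "\<mu> = \<alpha>" | "\<nu> = \<beta>" "\<mu> = \<beta>" | "\<nu> = \<beta>" "\<mu> = \<alpha>" | "\<nu> = \<alpha>" "\<mu> = \<beta>"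
      using D[OF p] D'[OF p'] by blast
    then show ?thesis
    proof cases
      case 1
      then have "\<delta> * (1 - \<alpha>) = \<epsilon> * (1 - \<alpha>)" using D[OF p] D'[OF p'] ev(3) by metis
      then show ?thesis using ev by simp
    next
      case 2
      then have "\<delta> * (1 - \<beta>) = \<epsilon> * (1 - \<beta>)" using D[OF p] D'[OF p'] ev(3) by metis
      then show ?thesis using ev by simp
    next
      case 3
      then have "2 * \<alpha> * \<beta> = - (\<beta> - 1)" using D[OF p] ev(3) by metis
      then show ?thesis using exceptional_pairI[OF ev U ind aa bb p[unfolded 3]] by blast
    next
      case 4
      then have "2 * \<alpha> * \<beta> = - (\<beta> - 1)" using D'[OF p'] ev(3) by metis
      then show ?thesis using exceptional_pairI[OF ev U' ind' bb aa p'[unfolded 4]] by blast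
    qed
  qed
  with excl proj show ?thesis by blast
qed

end
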